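(* If a Banach space $X$ is almost square (ASQ), then its dual $X^*$ is octahedral.
   Context: All Banach spaces are real. $S_X$ and $B_X$ denote the unit sphere and closed unit ball of $X$. A Banach space $X$ is almost square (ASQ) if for every finite subset $(x_i)_{i=1}^N \subset S_X$ there exists a sequence $(y_n)\subset B_X$ such that $\|x_i\pm y_n\|\to 1$ for every $i=1,\ldots,N$ and $\|y_n\|\to 1$. A Banach space $Z$ is octahedral if for every finite subset $(z_i)_{i=1}^N\subset S_Z$ and every $\varepsilon>0$ there exists $y\in S_Z$ such that $\|z_i\pm y\|\ge 2-\varepsilon$ for all $i=1,\ldots,N$. *)

theory Defs
  imports "HOL-Analysis.Analysis"
begin

definition almost_square :: "'a::banach itself \<Rightarrow> bool" where
  "almost_square (_ :: 'a itself) \<longleftrightarrow>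
     (\<forall>A :: 'a set. finite A \<and> A \<subseteq> sphere 0 1 \<longrightarrow>
        (\<exists>y :: nat \<Rightarrow> 'a. (\<forall>n. y n \<in> cball 0 1) \<and>
           (\<forall>x\<in>A. (\<lambda>n. norm (x + y n)) \<longlonglongrightarrow> 1 \<and> (\<lambda>n. norm (x - y n)) \<longlonglongrightarrow> 1) \<and>
           (\<lambda>n. norm (y n)) \<longlonglongrightarrow> 1))"

definition octahedral :: "'a::banach itself \<Rightarrow> bool" where
  "octahedral (_ :: 'a itself) \<longleftrightarrow>
     (\<forall>A :: 'a set. finite A \<and> A \<subseteq> sphere 0 1 \<longrightarrow>
        (\<forall>\<epsilon>>0. \<exists>y\<in>sphere 0 1. \<forall>z\<in>A. norm (z + y) \<ge> 2 - \<epsilon> \<and> norm (z - y) \<ge> 2 - \<epsilon>))"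

end

theory Submission
  imports Defs
begin

text \<open>
  Given norm-one functionals, choose unit vectors \<open>x\<close> at which they are almost normed and let
  \<open>y\<close> be an almost square direction for these vectors. Let \<open>g\<close> be a norm-one functional with
  \<open>g y = \<parallel>y\<parallel>\<close>. Since \<open>\<parallel>x \<plusminus> y\<parallel>\<close> is close to 1, a functional which is almost normed at one of
  \<open>x\<close>, \<open>y\<close> is small at the other, so \<open>(f \<plusminus> g) (x \<plusminus> y)\<close> is close to 2 for each given \<open>f\<close>.
  The functional \<open>g\<close> comes from Hahn--Banach, obtained here from the fact that a pointwise
  minimal sublinear functional is linear.
\<close>

section \<open>Sublinear functionals and norming functionals\<close>

definition sublinear :: "('a::real_vector \<Rightarrow> real) \<Rightarrow> bool" where
  "sublinear p \<longleftrightarrow> (\<forall>x y. p (x + y) \<le> p x + p y) \<and> (\<forall>c\<ge>0. \<forall>x. p (c *\<^sub>R x) = c * p x)"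

lemma sublinear_add: "sublinear p \<Longrightarrow> p (x + y) \<le> p x + p y"
  and sublinear_scaleR: "sublinear p \<Longrightarrow> c \<ge> 0 \<Longrightarrow> p (c *\<^sub>R x) = c * p x"
  by (auto simp: sublinear_def)

lemma sublinear_0: "sublinear p \<Longrightarrow> p 0 = 0"
  using sublinear_scaleR[of p 0 0] by simp

lemma sublinear_minus: "sublinear p \<Longrightarrow> - p (- x) \<le> p x"
  using sublinear_add[of p x "- x"] sublinear_0[of p] by simp

lemma sublinear_norm: "sublinear (norm :: 'a::real_normed_vector \<Rightarrow> real)"
  by (simp add: sublinear_def norm_triangle_ineq)

lemma sublinearI:
  assumes "\<And>x y. p (x + y) \<le> p x + p y"
    and "\<And>c x. c > 0 \<Longrightarrow> p (c *\<^sub>R x) \<le> c * p x" and "p 0 = 0"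
  shows "sublinear p"
proof -
  have "p (c *\<^sub>R x) = c * p x" if "c \<ge> 0" for c x
  proof (cases "c = 0")
    case False
    then have "c > 0" using that by simp
    \<comment> \<open>The assumed inequality, applied to \<open>inverse c\<close> and
      \<open>c *\<^sub>R x\<close>, gives its own reverse.\<close>
    have "p (inverse c *\<^sub>R c *\<^sub>R x) \<le> inverse c * p (c *\<^sub>R x)"
      using \<open>c > 0\<close> by (intro assms(2)) simp
    then have "c * p x \<le> p (c *\<^sub>R x)" using \<open>c > 0\<close> by (simp add: field_simps)
    with assms(2)[OF \<open>c > 0\<close>, of x] show ?thesis by simp
  qed (simp add: assms(3))
  with assms(1) show ?thesis by (simp add: sublinear_def)
qed

text \<open>Lowers \<open>p\<close> along \<open>z\<close> through the infimum of
  \<open>p (x + t *\<^sub>R z) - t * p z\<close> over \<open>t \<ge> 0\<close>. The value at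
  \<open>t = 0\<close> gives \<open>q \<le> p\<close>, and \<open>t = 1\<close> gives the other two
  bounds. The bound at \<open>x\<close> makes a minimal \<open>p\<close> additive; the one at
  \<open>- z\<close> forces every linear functional below \<open>q\<close> to be at least
  \<open>p z\<close> at \<open>z\<close>.\<close>

lemma sublinear_decrease:
  assumes p: "sublinear p"
  obtains q where "sublinear q" "q \<le> p" "q (- z) \<le> - p z"
    "\<And>x. q x \<le> p (x + z) - p z"
proof -
  define q where "q x = (INF t\<in>{0..}. p (x + t *\<^sub>R z) - t * p z)" for x
  \<comment> \<open>A bound free of \<open>t\<close>, from
    \<open>t * p z = p (t *\<^sub>R z)\<close> and subadditivity; it makes the infimum
    finite.\<close>
  have lb: "- p (- x) \<le> p (x + t *\<^sub>R z) - t * p z" if "t \<ge> 0" for x t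
    using sublinear_add[OF p, of "x + t *\<^sub>R z" "- x"] sublinear_scaleR[OF p that, of z]
    by simp
  have bdd: "bdd_below ((\<lambda>t. p (x + t *\<^sub>R z) - t * p z) ` {0..})" for x
    by (rule bdd_belowI2[of _ "- p (- x)"]) (use lb in auto)
  have le: "q x \<le> p (x + t *\<^sub>R z) - t * p z" if "t \<ge> 0" for x t
    unfolding q_def by (rule cINF_lower[OF bdd]) (use that in auto)
  have ge: "m \<le> q x" if "\<And>t. t \<ge> 0 \<Longrightarrow> m \<le> p (x + t *\<^sub>R z) - t * p z" for m x
    unfolding q_def by (rule cINF_greatest) (use that in auto)
  have "sublinear q"
  proof (rule sublinearI)
    fix x y
    \<comment> \<open>Parameters \<open>s\<close> for \<open>x\<close> and \<open>t\<close> for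
      \<open>y\<close> combine to \<open>s + t\<close> for \<open>x + y\<close>; the infimum is then
      taken over \<open>t\<close> first and over \<open>s\<close> next.\<close>
    have "q (x + y) - (p (x + s *\<^sub>R z) - s * p z) \<le> p (y + t *\<^sub>R z) - t * p z"
      if "s \<ge> 0" "t \<ge> 0" for s t
      using le[of "s + t" "x + y"] sublinear_add[OF p, of "x + s *\<^sub>R z" "y + t *\<^sub>R z"] that
      by (simp add: algebra_simps)
    then have "q (x + y) - (p (x + s *\<^sub>R z) - s * p z) \<le> q y" if "s \<ge> 0" for s
      using that by (intro ge) auto
    then have "q (x + y) - q y \<le> q x"
      by (intro ge) (simp add: algebra_simps)
    then show "q (x + y) \<le> q x + q y" by simp
  next
    fix c :: real and x assume "c > 0"
    \<comment> \<open>The parameter \<open>c * t\<close> at \<open>c *\<^sub>R x\<close> corresponds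
      to \<open>t\<close> at \<open>x\<close>.\<close>
    have "q (c *\<^sub>R x) / c \<le> p (x + t *\<^sub>R z) - t * p z" if "t \<ge> 0" for t
      using le[of "c * t" "c *\<^sub>R x"] sublinear_scaleR[OF p, of c "x + t *\<^sub>R z"] \<open>c > 0\<close> that
      by (simp add: field_simps scaleR_add_right)
    then have "q (c *\<^sub>R x) / c \<le> q x" by (rule ge)
    then show "q (c *\<^sub>R x) \<le> c * q x" using \<open>c > 0\<close> by (simp add: field_simps)
  next
    have "q 0 \<le> 0" using le[of 0 0] sublinear_0[OF p] by simp
    moreover have "0 \<le> q 0" using lb[of _ 0] sublinear_0[OF p] by (intro ge) simp
    ultimately show "q 0 = 0" by simp
  qed
  moreover have "q \<le> p" using le[of 0] by (simp add: le_fun_def)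
  moreover have "q (- z) \<le> - p z" using le[of 1 "- z"] sublinear_0[OF p] by simp
  moreover have "q x \<le> p (x + z) - p z" for x using le[of 1 x] by simp
  ultimately show ?thesis by (rule that)
qed

text \<open>Lowering along \<open>z\<close> cannot change a minimal \<open>p\<close>, so
  \<open>p x \<le> p (x + z) - p z\<close>, which is the missing superadditivity. Additivity makes
  \<open>p\<close> odd, and this settles negative scalars.\<close>

lemma minimal_sublinear_linear:
  assumes p: "sublinear p" and min: "\<And>q. sublinear q \<Longrightarrow> q \<le> p \<Longrightarrow> q = p"
  shows "linear p"
proof -
  have add: "p (x + z) = p x + p z" for x z
  proof -
    obtain q where "sublinear q" "q \<le> p" "q x \<le> p (x + z) - p z"
      using sublinear_decrease[OF p, of z] by metis
    with min have "p x \<le> p (x + z) - p z" by auto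
    with sublinear_add[OF p, of x z] show ?thesis by simp
  qed
  have neg: "p (- x) = - p x" for x
    using add[of x "- x"] sublinear_0[OF p] by simp
  have "p (c *\<^sub>R x) = c * p x" for c x
    using sublinear_scaleR[OF p, of c x] sublinear_scaleR[OF p, of "- c" x] neg[of "c *\<^sub>R x"]
    by (cases "c \<ge> 0") auto
  with add show ?thesis by (intro linearI) auto
qed

text \<open>Zorn's lemma gives a minimal sublinear functional below \<open>p\<close>; pointwise
  infima bound nonempty chains from below.\<close>

lemma linear_below_sublinear:
  assumes p: "sublinear p"
  obtains f where "linear f" "f \<le> p"
proof -
  define A where "A = {q. sublinear q \<and> q \<le> p}"
  \<comment> \<open>The order is reversed because Zorn's lemma yields maximal elements.\<close>
  have "partial_order_on A (relation_of (\<lambda>q r. r \<le> q) A)"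
    by (rule partial_order_on_relation_ofI) auto
  moreover have "\<exists>u\<in>A. \<forall>a\<in>C. u \<le> a" if C: "C \<in> Chains (relation_of (\<lambda>q r. r \<le> q) A)" for C
  proof (cases "C = {}")
    case True
    with p show ?thesis by (auto simp: A_def)
  next
    case False
    have CA: "C \<subseteq> A" using Chains_relation_of[OF C] .
    have total: "q \<le> r \<or> r \<le> q" if "q \<in> C" "r \<in> C" for q r
      using C that by (auto simp: Chains_def relation_of_def)
    define u where "u x = (INF q\<in>C. q x)" for x
    have lb: "- p (- x) \<le> q x" if "q \<in> C" for q x
    proof -
      have "sublinear q" "q (- x) \<le> p (- x)" using CA that by (auto simp: A_def le_fun_def)
      with sublinear_minus[of q x] show ?thesis by simp
    qed
    have le: "u x \<le> q x" if "q \<in> C" for q x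
      unfolding u_def by (rule cINF_lower[OF bdd_belowI2[of _ "- p (- x)"] that]) (rule lb)
    have ge: "m \<le> u x" if "\<And>q. q \<in> C \<Longrightarrow> m \<le> q x" for m x
      unfolding u_def by (rule cINF_greatest[OF False that])
    have sub: "sublinear q" if "q \<in> C" for q using CA that by (auto simp: A_def)
    have "sublinear u"
    proof (rule sublinearI)
      fix x y
      \<comment> \<open>Infima of subadditive functions need not be subadditive; here the smaller of
        \<open>q\<close> and \<open>r\<close>, which are comparable in the chain, serves at both
        points.\<close>
      have "u (x + y) - q x \<le> r y" if "q \<in> C" "r \<in> C" for q r
        using total[OF that]
      proof
        assume "q \<le> r"
        then have "q y \<le> r y" by (simp add: le_fun_def)
        with le[of q "x + y"] sublinear_add[OF sub, of q x y] that show ?thesis by simp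
      next
        assume "r \<le> q"
        then have "r x \<le> q x" by (simp add: le_fun_def)
        with le[of r "x + y"] sublinear_add[OF sub, of r x y] that show ?thesis by simp
      qed
      then have "u (x + y) - q x \<le> u y" if "q \<in> C" for q
        using that by (intro ge) auto
      then have "u (x + y) - u y \<le> u x"
        by (intro ge) (simp add: algebra_simps)
      then show "u (x + y) \<le> u x + u y" by simp
    next
      fix c :: real and x assume "c > 0"
      have "u (c *\<^sub>R x) / c \<le> q x" if "q \<in> C" for q
        using le[OF that, of "c *\<^sub>R x"] sublinear_scaleR[OF sub[OF that], of c x] \<open>c > 0\<close>
        by (simp add: field_simps)
      then have "u (c *\<^sub>R x) / c \<le> u x" by (rule ge)
      then show "u (c *\<^sub>R x) \<le> c * u x" using \<open>c > 0\<close> by (simp add: field_simps)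
    next
      have "(INF q\<in>C. q 0) = (INF q\<in>C. 0)" by (rule INF_cong) (auto simp: sublinear_0 sub)
      then show "u 0 = 0" using False by (simp add: u_def)
    qed
    moreover have "u \<le> p"
    proof -
      obtain q where "q \<in> C" using False by blast
      then have "u \<le> q" "q \<le> p" using le CA by (auto simp: le_fun_def A_def)
      then show ?thesis by (rule order_trans)
    qed
    ultimately have "u \<in> A" by (simp add: A_def)
    with le show ?thesis by (auto simp: le_fun_def)
  qed
  ultimately obtain f where "f \<in> A" and min: "\<forall>q\<in>A. q \<le> f \<longrightarrow> q = f"
    using predicate_Zorn[of A "\<lambda>q r. r \<le> q"] by blast
  then have f: "sublinear f" "f \<le> p" by (auto simp: A_def)
  have "linear f"
    using f(1) by (rule minimal_sublinear_linear) (use min f(2) in \<open>auto simp: A_def\<close>)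
  with f(2) show ?thesis by (rule that[rotated])
qed

text \<open>The norm is first lowered along \<open>y\<close>: a linear \<open>f\<close> below the
  result has \<open>f (- y) \<le> - norm y\<close>, while \<open>f\<close> below the norm gives the
  opposite bound and norm at most 1.\<close>

lemma norming_functional:
  fixes y :: "'a::real_normed_vector"
  assumes "y \<noteq> 0"
  obtains g :: "'a \<Rightarrow>\<^sub>L real" where "norm g = 1" "blinfun_apply g y = norm y"
proof -
  obtain q where q: "sublinear q" "q \<le> norm" "q (- y) \<le> - norm y"
    using sublinear_decrease[OF sublinear_norm, of y] by metis
  obtain f where f: "linear f" "f \<le> q" using linear_below_sublinear[OF q(1)] .
  have le: "f x \<le> norm x" for x
    using order_trans[OF f(2) q(2)] by (simp add: le_fun_def)
  have abs_le: "\<bar>f x\<bar> \<le> norm x" for x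
    using le[of x] le[of "- x"] linear_neg[OF f(1), of x] by auto
  have "f (- y) \<le> - norm y" using f(2) q(3) by (metis le_funD order_trans)
  then have fy: "f y = norm y" using le[of y] linear_neg[OF f(1), of y] by simp
  have bl: "bounded_linear f"
    using f(1) abs_le by (intro linear_conv_bounded_linear[THEN iffD1] bounded_linear_intro[of f 1])
      (auto simp: linear_add linear_scale)
  define g where "g = Blinfun f"
  have g: "blinfun_apply g = f" unfolding g_def by (rule bounded_linear_Blinfun_apply[OF bl])
  have "norm g \<le> 1" by (rule norm_blinfun_bound) (auto simp: g abs_le)
  moreover have "norm y \<le> norm g * norm y" using norm_blinfun[of g y] by (simp add: g fy)
  then have "1 \<le> norm g" using assms by simp
  ultimately show ?thesis using that[of g] by (simp add: g fy)
qed

section \<open>Estimates for almost normed functionals\<close>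

lemma blinfun_almost_normed:
  fixes f :: "'a::real_normed_vector \<Rightarrow>\<^sub>L real"
  assumes "norm f = 1" "\<delta> > 0"
  obtains x where "norm x = 1" "blinfun_apply f x > 1 - \<delta>"
proof -
  have "\<exists>x. norm x = 1 \<and> f x > 1 - \<delta>"
  proof (rule ccontr)
    assume *: "\<not> ?thesis"
    \<comment> \<open>The maximum with 0 keeps the bound nonnegative when
      \<open>\<delta> > 1\<close>; \<open>m < 1\<close> contradicts
      \<open>norm f = 1\<close>.\<close>
    define m where "m = max 0 (1 - \<delta>)"
    have unit: "f u \<le> m" if "norm u = 1" for u
      using * that by (auto simp: m_def max_def not_less intro: order_trans)
    have "norm (f x) \<le> m * norm x" for x
    proof (cases "x = 0")
      case False
      have "f (sgn x) \<le> m" "f (- sgn x) \<le> m"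
        using False by (auto intro!: unit simp: norm_sgn)
      then show ?thesis using False
        by (auto simp: sgn_div_norm blinfun.scaleR_right blinfun.minus_right field_simps)
    qed simp
    then have "norm f \<le> m" by (intro norm_blinfun_bound) (auto simp: m_def)
    with assms show False by (simp add: m_def)
  qed
  with that show ?thesis by blast
qed

text \<open>Both \<open>f x + f y\<close> and \<open>f x - f y\<close> are at most
  \<open>1 + \<delta>\<close>, and \<open>f x\<close> already uses up
  \<open>1 - \<delta>\<close>.\<close>

lemma abs_blinfun_small:
  fixes f :: "'a::real_normed_vector \<Rightarrow>\<^sub>L real"
  assumes "norm f = 1" "f x \<ge> 1 - \<delta>" "norm (x + y) \<le> 1 + \<delta>" "norm (x - y) \<le> 1 + \<delta>"
  shows "\<bar>f y\<bar> \<le> 2 * \<delta>"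
  using norm_blinfun[of f "x + y"] norm_blinfun[of f "x - y"] assms
  by (auto simp: blinfun.add_right blinfun.diff_right)

text \<open>At \<open>x + y\<close> the main terms lose \<open>2 * \<delta>\<close> and the two
  cross terms \<open>4 * \<delta>\<close>. Passing from
  \<open>norm (x + y) \<le> 1 + \<delta>\<close> to norm 1 costs another
  \<open>2 * \<delta>\<close>, since \<open>norm (f + g) \<le> 2\<close>.\<close>

lemma norm_add_functionals_ge:
  fixes f g :: "'a::real_normed_vector \<Rightarrow>\<^sub>L real"
  assumes f: "norm f = 1" "f x \<ge> 1 - \<delta>" and g: "norm g = 1" "g y \<ge> 1 - \<delta>"
    and xy: "norm (x + y) \<le> 1 + \<delta>" "norm (x - y) \<le> 1 + \<delta>" and "\<delta> \<ge> 0"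
  shows "norm (f + g) \<ge> 2 - 8 * \<delta>"
proof -
  have "\<bar>f y\<bar> \<le> 2 * \<delta>" using f xy by (rule abs_blinfun_small)
  moreover have "\<bar>g x\<bar> \<le> 2 * \<delta>"
    using g xy by (intro abs_blinfun_small[where x = y]) (auto simp: add.commute norm_minus_commute)
  moreover have "(f + g) (x + y) = f x + f y + (g x + g y)"
    by (simp add: blinfun.add_left blinfun.add_right)
  ultimately have "2 - 6 * \<delta> \<le> (f + g) (x + y)" using f(2) g(2) by linarith
  also have "\<dots> \<le> norm (f + g) * norm (x + y)" using norm_blinfun[of "f + g" "x + y"] by simp
  also have "\<dots> \<le> norm (f + g) * (1 + \<delta>)" using xy(1) by (intro mult_left_mono) auto
  also have "\<dots> \<le> norm (f + g) + 2 * \<delta>"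
    using norm_triangle_ineq[of f g] f(1) g(1) mult_right_mono[of "norm (f + g)" 2 \<delta>] \<open>\<delta> \<ge> 0\<close>
    by (simp add: algebra_simps)
  finally show ?thesis by simp
qed

theorem proposition2p5:
  assumes "almost_square TYPE('a::banach)"
  shows "octahedral TYPE('a \<Rightarrow>\<^sub>L real)"
  unfolding octahedral_def
proof (intro allI impI)
  fix A :: "('a \<Rightarrow>\<^sub>L real) set" and \<epsilon> :: real
  assume A: "finite A \<and> A \<subseteq> sphere 0 1" and "\<epsilon> > 0"
  \<comment> \<open>The factor 8 matches the loss in \<open>norm_add_functionals_ge\<close>; the cap
    1/2 ensures \<open>y n \<noteq> 0\<close> below.\<close>
  define \<delta> where "\<delta> = min (1/2) (\<epsilon> / 8)"
  have \<delta>: "\<delta> > 0" "\<delta> < 1" "8 * \<delta> \<le> \<epsilon>" using \<open>\<epsilon> > 0\<close> by (auto simp: \<delta>_def)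
  have norm1: "norm f = 1" if "f \<in> A" for f using A that by auto
  have "\<forall>f\<in>A. \<exists>x. norm x = 1 \<and> blinfun_apply f x > 1 - \<delta>"
    using blinfun_almost_normed norm1 \<delta>(1) by metis
  then obtain X where X: "\<And>f. f \<in> A \<Longrightarrow> norm (X f) = 1"
    "\<And>f. f \<in> A \<Longrightarrow> blinfun_apply f (X f) > 1 - \<delta>" by metis
  have "finite (X ` A) \<and> X ` A \<subseteq> sphere 0 1" using A X(1) by auto
  then obtain y where lim: "\<And>f. f \<in> A \<Longrightarrow> (\<lambda>n. norm (X f + y n)) \<longlonglongrightarrow> 1"
      "\<And>f. f \<in> A \<Longrightarrow> (\<lambda>n. norm (X f - y n)) \<longlonglongrightarrow> 1" "(\<lambda>n. norm (y n)) \<longlonglongrightarrow> 1"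
    using assms unfolding almost_square_def by (metis imageI)
  \<comment> \<open>Finiteness of \<open>A\<close> lets a single index serve all
    functionals.\<close>
  have "\<forall>\<^sub>F n in sequentially. \<forall>f\<in>A. norm (X f + y n) < 1 + \<delta> \<and> norm (X f - y n) < 1 + \<delta>"
    using A \<delta>(1) by (intro eventually_ball_finite ballI eventually_conj
      order_tendstoD(2)[OF lim(1)] order_tendstoD(2)[OF lim(2)]) auto
  moreover have "\<forall>\<^sub>F n in sequentially. norm (y n) > 1 - \<delta>"
    using \<delta>(1) by (intro order_tendstoD(1)[OF lim(3)]) simp
  ultimately have "\<forall>\<^sub>F n in sequentially. norm (y n) > 1 - \<delta> \<and>
      (\<forall>f\<in>A. norm (X f + y n) < 1 + \<delta> \<and> norm (X f - y n) < 1 + \<delta>)"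
    by eventually_elim simp
  then obtain n where n: "norm (y n) > 1 - \<delta>"
      "\<And>f. f \<in> A \<Longrightarrow> norm (X f + y n) < 1 + \<delta>" "\<And>f. f \<in> A \<Longrightarrow> norm (X f - y n) < 1 + \<delta>"
    by (metis (mono_tags, lifting) eventually_happens trivial_limit_sequentially)
  have "y n \<noteq> 0" using n(1) \<delta>(2) by auto
  then obtain g :: "'a \<Rightarrow>\<^sub>L real" where g: "norm g = 1" "blinfun_apply g (y n) = norm (y n)"
    by (rule norming_functional)
  have "norm (f + g) \<ge> 2 - \<epsilon> \<and> norm (f - g) \<ge> 2 - \<epsilon>" if "f \<in> A" for f
  proof -
    have "norm (f + g) \<ge> 2 - 8 * \<delta>"
      using norm1[OF that] X(2)[OF that] g n(1) n(2,3)[OF that] \<delta>(1)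
      by (intro norm_add_functionals_ge[where x = "X f" and y = "y n"]) auto
    \<comment> \<open>Replacing \<open>g\<close> and \<open>y n\<close> by their negatives preserves
      \<open>g (y n)\<close> and swaps the two norm bounds.\<close>
    moreover have "norm (f + - g) \<ge> 2 - 8 * \<delta>"
      using norm1[OF that] X(2)[OF that] g n(1) n(2,3)[OF that] \<delta>(1)
      by (intro norm_add_functionals_ge[where x = "X f" and y = "- y n"])
        (auto simp: blinfun.minus_left blinfun.minus_right)
    ultimately show ?thesis using \<delta>(3) by simp
  qed
  with g(1) show "\<exists>g\<in>sphere 0 1. \<forall>f\<in>A. norm (f + g) \<ge> 2 - \<epsilon> \<and> norm (f - g) \<ge> 2 - \<epsilon>"
    by (intro bexI[of _ g]) auto
qed

end
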